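(* Let $N=\{1,\dots,n\}$ be a finite player set, let $\mathbb V^N_\star$ be the class of regular cooperative games on $N$ and $\widehat{\mathbb V}^N\subseteq\mathbb V^N_\star$ the class of regular zero-normalised games. The Gately value $g\colon\mathbb V^N_\star\to\mathbb R^N$ is the unique map $f\colon\mathbb V^N_\star\to\mathbb R^N$ that satisfies the following three properties: (i) Efficiency: $\sum_{i\in N}f_i(v)=v(N)$ for every $v\in\mathbb V^N_\star$; (ii) $\nu_v$-Compromise property: for every $v\in\mathbb V^N_\star$, $f(v)=\nu_v+f(v-\nu_v)$, where $\nu_v=(v_1,\dots,v_n)$ and $v-\nu_v\in\widehat{\mathbb V}^N$ is the zero-normalisation of $v$, defined by $(v-\nu_v)(S)=v(S)-\sum_{i\in S}v_i$ for every $S\subseteq N$; (iii) Restricted proportionality property: for every $v\in\widehat{\mathbb V}^N$ there is some $\gamma_v\in\mathbb R$ with $f(v)=\gamma_v\,M(v)$.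
   Context: A cooperative game on $N$ is a function $v\colon 2^N\to\mathbb R$ with $v(\varnothing)=0$. Write $v_i=v(\{i\})$, $M_i(v)=v(N)-v(N\setminus\{i\})$ and $M(v)=(M_1(v),\dots,M_n(v))$. The game $v$ is regular if: (essential) $\sum_{j\in N}v_j\leqslant v(N)\leqslant\sum_{j\in N}M_j(v)$; and (standard) $v_i\leqslant M_i(v)$ for every $i\in N$, with $v_j<M_j(v)$ for at least one $j\in N$. The game $v$ is zero-normalised if $v_i=0$ for all $i\in N$. The Gately value $g\colon\mathbb V^N_\star\to\mathbb R^N$ is given by $$g_i(v)=v_i+\frac{M_i(v)-v_i}{\sum_{j\in N}(M_j(v)-v_j)}\Big(v(N)-\sum_{j\in N}v_j\Big),\qquad i\in N.$$ *)

theory Defs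
  imports "HOL-Analysis.Analysis"
begin

text \<open>
  The player set is the universe of a finite type \<open>'n\<close> (so \<open>n = CARD('n)\<close>), and payoff
  vectors are elements of \<open>real ^ 'n\<close>.
\<close>

type_synonym 'n game = "'n set \<Rightarrow> real"

definition cooperative_game :: "'n game \<Rightarrow> bool" where
  "cooperative_game v \<longleftrightarrow> v {} = 0"

definition singleton_worths :: "('n::finite) game \<Rightarrow> real ^ 'n" where
  "singleton_worths v = (\<chi> i. v {i})"

definition marginals :: "('n::finite) game \<Rightarrow> real ^ 'n" where
  "marginals v = (\<chi> i. v UNIV - v (UNIV - {i}))"

definition essential_game :: "('n::finite) game \<Rightarrow> bool" where
  "essential_game v \<longleftrightarrow>
     (\<Sum>j\<in>UNIV. v {j}) \<le> v UNIV \<and> v UNIV \<le> (\<Sum>j\<in>UNIV. marginals v $ j)"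

definition standard_game :: "('n::finite) game \<Rightarrow> bool" where
  "standard_game v \<longleftrightarrow>
     (\<forall>i. v {i} \<le> marginals v $ i) \<and> (\<exists>j. v {j} < marginals v $ j)"

definition regular_games :: "('n::finite) game set" where
  "regular_games = {v. cooperative_game v \<and> essential_game v \<and> standard_game v}"

definition zero_normalised :: "'n game \<Rightarrow> bool" where
  "zero_normalised v \<longleftrightarrow> (\<forall>i. v {i} = 0)"

definition regular_zero_normalised_games :: "('n::finite) game set" where
  "regular_zero_normalised_games = {v \<in> regular_games. zero_normalised v}"

definition zero_normalisation :: "('n::finite) game \<Rightarrow> 'n game" where
  "zero_normalisation v = (\<lambda>S. v S - (\<Sum>i\<in>S. v {i}))"

definition gately_value :: "('n::finite) game \<Rightarrow> real ^ 'n" where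
  "gately_value v = (\<chi> i. v {i} +
     (marginals v $ i - v {i}) / (\<Sum>j\<in>UNIV. marginals v $ j - v {j}) *
     (v UNIV - (\<Sum>j\<in>UNIV. v {j})))"

text \<open>
  A value on the class of regular games is represented by a total function on games; the
  properties below, and equality of values, only concern its restriction to
  \<open>regular_games\<close>.
\<close>

definition efficient :: "(('n::finite) game \<Rightarrow> real ^ 'n) \<Rightarrow> bool" where
  "efficient f \<longleftrightarrow> (\<forall>v\<in>regular_games. (\<Sum>i\<in>UNIV. f v $ i) = v UNIV)"

definition compromise_property :: "(('n::finite) game \<Rightarrow> real ^ 'n) \<Rightarrow> bool" where
  "compromise_property f \<longleftrightarrow>
     (\<forall>v\<in>regular_games. f v = singleton_worths v + f (zero_normalisation v))"

definition restricted_proportionality :: "(('n::finite) game \<Rightarrow> real ^ 'n) \<Rightarrow> bool" where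
  "restricted_proportionality f \<longleftrightarrow>
     (\<forall>v\<in>regular_zero_normalised_games. \<exists>\<gamma>::real. f v = \<gamma> *\<^sub>R marginals v)"

end

theory Submission
  imports Defs
begin

text \<open>
  On a zero-normalised regular game, restricted proportionality leaves a single scalar free, and
  efficiency fixes it because regularity makes the sum of the marginal contributions positive.
  The compromise property reduces every regular game to this case.
\<close>

lemma zero_normalisation_singleton [simp]: "zero_normalisation v {i} = 0"
  by (simp add: zero_normalisation_def)

lemma zero_normalisation_UNIV: "zero_normalisation v UNIV = v UNIV - (\<Sum>j\<in>UNIV. v {j})"
  by (simp add: zero_normalisation_def)

text \<open>The sums subtracted at the grand coalition and at the coalition missing \<open>i\<close>
  differ by exactly \<open>v {i}\<close>.\<close>

lemma marginals_zero_normalisation: "marginals (zero_normalisation v) $ i = marginals v $ i - v {i}"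
  by (simp add: marginals_def zero_normalisation_def sum_diff1)

text \<open>Both sides of each regularity inequality drop by the same amount: the sum of all
  singleton worths in the essential bounds, \<open>v {i}\<close> in the standard ones.\<close>

lemma zero_normalisation_regular:
  assumes "v \<in> regular_games"
  shows "zero_normalisation v \<in> regular_zero_normalised_games"
  using assms
  by (auto simp: regular_zero_normalised_games_def regular_games_def zero_normalised_def
      cooperative_game_def essential_game_def standard_game_def marginals_zero_normalisation
      zero_normalisation_UNIV sum_subtractf)
    (simp add: zero_normalisation_def)

text \<open>Standardness makes every summand nonnegative and one of them positive. This keeps the
  denominator of the Gately value away from 0.\<close>

lemma sum_marginal_surplus_pos:
  assumes "v \<in> regular_games"
  shows "(\<Sum>j\<in>UNIV. marginals v $ j - v {j}) > 0"
proof -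
  from assms have "\<And>i. v {i} \<le> marginals v $ i" and "\<exists>j. v {j} < marginals v $ j"
    by (auto simp: regular_games_def standard_game_def)
  then show ?thesis
    by (auto intro: sum_pos2)
qed

lemma gately_value_zero_normalised:
  assumes "zero_normalised v"
  shows "gately_value v = (v UNIV / (\<Sum>j\<in>UNIV. marginals v $ j)) *\<^sub>R marginals v"
  using assms by (simp add: gately_value_def zero_normalised_def vec_eq_iff)

lemma gately_value_efficient: "efficient gately_value"
  unfolding efficient_def
proof
  fix v :: "'n::finite game"
  assume "v \<in> regular_games"
  note pos = sum_marginal_surplus_pos[OF this]
  have "(\<Sum>i\<in>UNIV. gately_value v $ i) =
      (\<Sum>i\<in>UNIV. v {i}) +
      (\<Sum>i\<in>UNIV. marginals v $ i - v {i}) / (\<Sum>j\<in>UNIV. marginals v $ j - v {j}) *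
      (v UNIV - (\<Sum>j\<in>UNIV. v {j}))"
    \<comment> \<open>The denominator and the last factor do not depend on \<open>i\<close>, so on
      the right they move under the sum and meet the expanded left side.\<close>
    by (simp only: gately_value_def vec_lambda_beta sum.distrib sum_divide_distrib sum_distrib_right)
  also have "\<dots> = v UNIV"
    using pos by simp
  finally show "(\<Sum>i\<in>UNIV. gately_value v $ i) = v UNIV" .
qed

text \<open>The surplus of \<open>i\<close> over \<open>v {i}\<close> and the surplus of the grand
  coalition are the marginal and the total worth of \<open>zero_normalisation v\<close>, whose
  singletons are worth 0. So the second summand of the Gately formula is already the Gately value of
  that game.\<close>

lemma gately_value_compromise: "compromise_property gately_value"
  by (simp add: compromise_property_def gately_value_def singleton_worths_def vec_eq_iff
      marginals_zero_normalisation zero_normalisation_UNIV)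

lemma gately_value_proportional: "restricted_proportionality gately_value"
  unfolding restricted_proportionality_def regular_zero_normalised_games_def
  by (blast intro: gately_value_zero_normalised)

lemma efficient_proportional_eq_gately_value:
  assumes eff: "efficient f" and proportional: "restricted_proportionality f"
    and v: "v \<in> regular_zero_normalised_games"
  shows "f v = gately_value v"
proof -
  from v have reg: "v \<in> regular_games" and zero: "zero_normalised v"
    by (auto simp: regular_zero_normalised_games_def)
  have pos: "(\<Sum>j\<in>UNIV. marginals v $ j) > 0"
    using sum_marginal_surplus_pos[OF reg] zero by (simp add: zero_normalised_def)
  obtain \<gamma> where \<gamma>: "f v = \<gamma> *\<^sub>R marginals v"
    using proportional v by (auto simp: restricted_proportionality_def)
  have "v UNIV = (\<Sum>i\<in>UNIV. f v $ i)"
    using eff reg by (simp add: efficient_def)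
  also have "\<dots> = \<gamma> * (\<Sum>j\<in>UNIV. marginals v $ j)"
    by (simp add: \<gamma> sum_distrib_left)
  finally have "\<gamma> = v UNIV / (\<Sum>j\<in>UNIV. marginals v $ j)"
    using pos by simp
  then show ?thesis
    by (simp add: \<gamma> gately_value_zero_normalised[OF zero])
qed

theorem theorem3p11:
  shows "(\<forall>v \<in> (regular_games :: ('n::finite) game set).
            zero_normalisation v \<in> regular_zero_normalised_games)
       \<and> efficient (gately_value :: 'n game \<Rightarrow> real ^ 'n)
       \<and> compromise_property (gately_value :: 'n game \<Rightarrow> real ^ 'n)
       \<and> restricted_proportionality (gately_value :: 'n game \<Rightarrow> real ^ 'n)
       \<and> (\<forall>f :: 'n game \<Rightarrow> real ^ 'n.
            efficient f \<and> compromise_property f \<and> restricted_proportionality f \<longrightarrow>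
            (\<forall>v \<in> regular_games. f v = gately_value v))"
proof (intro conjI allI impI ballI)
  fix v :: "'n game"
  assume "v \<in> regular_games"
  then show "zero_normalisation v \<in> regular_zero_normalised_games"
    by (rule zero_normalisation_regular)
next
  fix f :: "'n game \<Rightarrow> real ^ 'n" and v :: "'n game"
  assume f: "efficient f \<and> compromise_property f \<and> restricted_proportionality f"
    and v: "v \<in> regular_games"
  have "f v = singleton_worths v + f (zero_normalisation v)"
    using f v by (simp add: compromise_property_def)
  also have "f (zero_normalisation v) = gately_value (zero_normalisation v)"
    using f v by (simp add: efficient_proportional_eq_gately_value zero_normalisation_regular)
  \<comment> \<open>The Gately value has the compromise property too; read backwards, it reassembles
    the value of \<open>v\<close>.\<close>
  also have "singleton_worths v + gately_value (zero_normalisation v) = gately_value v"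
    using gately_value_compromise v by (metis compromise_property_def)
  finally show "f v = gately_value v" .
qed (fact gately_value_efficient gately_value_compromise gately_value_proportional)+

end
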